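(* Every Sturmian word $\mathbf{s}$ satisfies $\mathrm{rep}(\mathbf{s})\le \sqrt{10}-\frac32$.
   Context: A Sturmian word is an infinite word $\mathbf{s}$ over a finite alphabet whose number $p(n,\mathbf{s})$ of distinct factors of length $n$ equals $n+1$ for every $n\ge1$. For an infinite word $\mathbf{x}=x_1x_2\ldots$, with $x_i^j=x_i\cdots x_j$, let $r(n,\mathbf{x})=\min\{m\ge1:\ x_i^{i+n-1}=x_{m-n+1}^{m}\text{ for some } 1\le i\le m-n\}$, and $\mathrm{rep}(\mathbf{x})=\liminf_{n\to\infty} r(n,\mathbf{x})/n$. *)

theory Defs
  imports "HOL-Analysis.Analysis"
begin

text \<open>Infinite words are functions nat => 'a, indexed from 0: the paper's letter x_k
is x (k - 1).  factor x j n is the factor of length n starting at (0-based) position j.\<close>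

definition factor :: "(nat \<Rightarrow> 'a) \<Rightarrow> nat \<Rightarrow> nat \<Rightarrow> 'a list" where
  "factor x j n = map (\<lambda>k. x (j + k)) [0..<n]"

definition complexity :: "nat \<Rightarrow> (nat \<Rightarrow> 'a) \<Rightarrow> nat" where
  "complexity n x = card {factor x j n | j. True}"

definition sturmian :: "(nat \<Rightarrow> 'a) \<Rightarrow> bool" where
  "sturmian s \<longleftrightarrow> finite (range s) \<and> (\<forall>n\<ge>1. complexity n s = n + 1)"

text \<open>r(n,x) = min{m >= 1 : x_i..x_{i+n-1} = x_{m-n+1}..x_m for some 1 <= i <= m-n}.
In 0-based indexing x_i..x_{i+n-1} is factor x (i-1) n and x_{m-n+1}..x_m is factor x (m-n) n.\<close>
definition rep_fun :: "nat \<Rightarrow> (nat \<Rightarrow> 'a) \<Rightarrow> nat" where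
  "rep_fun n x = (LEAST m. m \<ge> 1 \<and> (\<exists>i. 1 \<le> i \<and> i + n \<le> m \<and>
                     factor x (i - 1) n = factor x (m - n) n))"

definition rep :: "(nat \<Rightarrow> 'a) \<Rightarrow> ereal" where
  "rep x = Liminf sequentially (\<lambda>n. ereal (real (rep_fun n x) / real n))"

end

theory Submission
  imports Defs
begin

text \<open>
  Extend \<open>s\<close> to a two-sided word \<open>z\<close> with the same factors. A bispecial factor of length
  \<open>p + q - 2\<close> recurs with gaps \<open>p \<le> q\<close> only. One of the two gaps never occurs twice in a row,
  and merging it with the preceding gap leads to the next bispecial factor, with gaps
  \<open>(p, p + q)\<close> or \<open>(q, p + q)\<close>. The first occurrence \<open>e \<ge> 0\<close> and the two gaps at \<open>e\<close> evolve along,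
  and each of them gives a repetition, hence an upper bound on \<open>rep_fun\<close>.

  If \<open>rep_fun n s > (1 + \<gamma>) n\<close> for all large \<open>n\<close> with \<open>\<gamma> > sqrt 10 - 5 / 2\<close>, these bounds are
  linear inequalities in \<open>p, q, e\<close> at every level. They force the gap that ends at \<open>e\<close> to be long
  and the one that starts at \<open>e\<close> to be short, and then exclude enough patterns of kept gaps to make
  their sequence eventually periodic with period short, long, long, long, i.e. the slope has eventual
  continued fraction period 2, 1, 1. The linear recurrence along a period contradicts the choice of
  \<open>\<gamma>\<close>.
\<close>

section \<open>Factors and eventual periodicity\<close>

definition agree :: "('i::linordered_semidom \<Rightarrow> 'a) \<Rightarrow> 'i \<Rightarrow> 'i \<Rightarrow> 'i \<Rightarrow> bool" where
  "agree x i j n \<longleftrightarrow> (\<forall>k\<in>{0..<n}. x (i + k) = x (j + k))"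

definition right_special :: "('i::linordered_semidom \<Rightarrow> 'a) \<Rightarrow> 'i \<Rightarrow> 'i \<Rightarrow> bool" where
  "right_special x n i \<longleftrightarrow> (\<exists>j. agree x i j n \<and> x (i + n) \<noteq> x (j + n))"

definition unique_right_special :: "('i::linordered_semidom \<Rightarrow> 'a) \<Rightarrow> bool" where
  "unique_right_special x \<longleftrightarrow>
     (\<forall>n i j. right_special x n i \<longrightarrow> right_special x n j \<longrightarrow> agree x i j n)"

definition eventually_periodic :: "(nat \<Rightarrow> 'a) \<Rightarrow> bool" where
  "eventually_periodic x \<longleftrightarrow> (\<exists>M p. 0 < p \<and> (\<forall>i\<ge>M. x (i + p) = x i))"

definition factors :: "(nat \<Rightarrow> 'a) \<Rightarrow> nat \<Rightarrow> 'a list set" where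
  "factors x n = range (\<lambda>j. factor x j n)"

lemma agreeD: "agree x i j n \<Longrightarrow> 0 \<le> k \<Longrightarrow> k < n \<Longrightarrow> x (i + k) = x (j + k)"
  by (simp add: agree_def)

lemma agree_drop:
  fixes z :: "int \<Rightarrow> 'a"
  assumes "agree z i j n" "0 \<le> k"
  shows "agree z (i + k) (j + k) (n - k)"
  unfolding agree_def
proof
  fix l assume "l \<in> {0..<n - k}"
  then show "z (i + k + l) = z (j + k + l)"
    using agreeD [OF assms(1), of "k + l"] assms(2) by (simp add: add.assoc)
qed

lemma agree_overlap:
  fixes z :: "int \<Rightarrow> 'a"
  assumes "agree z i j m" "agree z (i + k) (j + k) n" "k \<le> m"
  shows "agree z i j (k + n)"
  unfolding agree_def
proof
  fix l assume l: "l \<in> {0..<k + n}"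
  show "z (i + l) = z (j + l)"
  proof (cases "l < m")
    case True
    then show ?thesis using agreeD [OF assms(1)] l by simp
  next
    case False
    then show ?thesis using agreeD [OF assms(2), of "l - k"] assms(3) l by simp
  qed
qed

lemma agree_snoc:
  fixes z :: "int \<Rightarrow> 'a"
  assumes "agree z i j n" "z (i + n) = z (j + n)"
  shows "agree z i j (n + 1)"
  using assms by (auto simp: agree_def zless_add1_eq)

lemma agree_cons:
  fixes z :: "int \<Rightarrow> 'a"
  assumes "agree z i j n" "z (i - 1) = z (j - 1)"
  shows "agree z (i - 1) (j - 1) (n + 1)"
proof -
  have "agree z (i - 1) (j - 1) 1"
    using agree_snoc [of z "i - 1" "j - 1" 0] assms(2) by (simp add: agree_def)
  then show ?thesis
    using agree_overlap [of z "i - 1" "j - 1" 1 1 n] assms(1) by (simp add: add.commute)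
qed

lemma factor_eq_iff: "factor x i n = factor y j n \<longleftrightarrow> (\<forall>k<n. x (i + k) = y (j + k))"
  by (auto simp: factor_def list_eq_iff_nth_eq)

lemma factor_eq_iff_agree: "factor x i n = factor x j n \<longleftrightarrow> agree x i j n"
  by (simp add: factor_eq_iff agree_def atLeast0LessThan Ball_def)

lemma take_factor: "m \<le> n \<Longrightarrow> take m (factor x j n) = factor x j m"
  by (simp add: factor_def take_map)

lemma factor_in_factors: "factor x j n \<in> factors x n"
  by (simp add: factors_def)

lemma complexity_eq_card: "complexity n x = card (factors x n)"
  unfolding complexity_def factors_def by (simp add: full_SetCompr_eq)

lemma finite_factors:
  assumes "finite (range x)"
  shows "finite (factors x n)"
proof (rule finite_subset)
  show "factors x n \<subseteq> {xs. set xs \<subseteq> range x \<and> length xs = n}"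
    by (auto simp: factors_def factor_def)
  show "finite {xs. set xs \<subseteq> range x \<and> length xs = n}"
    using assms by (rule finite_lists_length_eq)
qed

lemma take_factors_Suc: "take n ` factors x (Suc n) = factors x n"
  by (auto simp: factors_def image_image take_factor)

lemma card_factors_bounded_if_eventually_periodic:
  assumes "eventually_periodic x"
  shows "\<exists>B. \<forall>n. card (factors x n) \<le> B"
proof -
  obtain M p where "0 < p" and periodic: "\<And>i. i \<ge> M \<Longrightarrow> x (i + p) = x i"
    using assms unfolding eventually_periodic_def by blast
  have early: "factor x j n \<in> (\<lambda>j. factor x j n) ` {..<M + p}" for j n
  proof (induction j rule: less_induct)
    case (less j)
    show ?case
    proof (cases "j < M + p")
      case False
      then have "x (j + k) = x (j - p + k)" for k
        using periodic [of "j - p + k"] by (simp add: add.commute add.left_commute)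
      then have "factor x j n = factor x (j - p) n"
        by (simp add: factor_eq_iff)
      then show ?thesis
        using less [of "j - p"] False \<open>0 < p\<close> by simp
    qed blast
  qed
  have "card (factors x n) \<le> M + p" for n
    using surj_card_le [of "{..<M + p}" "factors x n"] early by (auto simp: factors_def)
  then show ?thesis by blast
qed

lemma eventually_periodic_if_deterministic:
  assumes det: "\<And>i j. factor x i n = factor x j n \<Longrightarrow> x (i + n) = x (j + n)"
    and "i < j" and repeat: "factor x i n = factor x j n"
  shows "eventually_periodic x"
proof -
  have window: "factor x (i + m) n = factor x (j + m) n" for m
  proof (induction m)
    case (Suc m)
    have "x (i + Suc m + k) = x (j + Suc m + k)" if "k < n" for k
    proof (cases "Suc k = n")
      case True
      then show ?thesis using det [OF Suc] by auto
    next
      case False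
      then have "Suc k < n" using that by simp
      then have "x (i + m + Suc k) = x (j + m + Suc k)"
        using Suc unfolding factor_eq_iff by blast
      then show ?thesis by simp
    qed
    then show ?case by (simp add: factor_eq_iff)
  qed (use repeat in simp)
  have "x (m + (j - i)) = x m" if "m \<ge> i + n" for m
    using det [OF window [of "m - n - i"]] that \<open>i < j\<close> by (simp add: add.commute)
  then show ?thesis
    unfolding eventually_periodic_def using \<open>i < j\<close> by (metis zero_less_diff)
qed

lemma eventually_periodic_if_no_growth:
  assumes fin: "finite (range x)" and no_growth: "card (factors x (Suc n)) \<le> card (factors x n)"
  shows "eventually_periodic x"
proof -
  have "card (take n ` factors x (Suc n)) = card (factors x (Suc n))"
    using no_growth card_image_le [OF finite_factors [OF fin], of "take n" "Suc n"]
    by (simp add: take_factors_Suc)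
  then have inj: "inj_on (take n) (factors x (Suc n))"
    using eq_card_imp_inj_on finite_factors [OF fin] by blast
  have det: "x (i + n) = x (j + n)" if "factor x i n = factor x j n" for i j
  proof -
    have "factor x i (Suc n) = factor x j (Suc n)"
      by (rule inj_onD [OF inj]) (simp_all add: take_factor factor_in_factors that)
    then show ?thesis by (simp add: factor_eq_iff)
  qed
  have "\<not> inj (\<lambda>j. factor x j n)"
    using finite_factors [OF fin, of n] finite_imageD unfolding factors_def by blast
  then obtain i j where "i < j" "factor x i n = factor x j n"
    unfolding inj_on_def by (metis linorder_neqE_nat)
  then show ?thesis using eventually_periodic_if_deterministic det by blast
qed

lemma Morse_Hedlund:
  assumes fin: "finite (range x)" and small: "card (factors x n) \<le> n"
  shows "eventually_periodic x"
proof (rule ccontr)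
  assume "\<not> eventually_periodic x"
  then have grow: "card (factors x m) < card (factors x (Suc m))" for m
    using eventually_periodic_if_no_growth [OF fin] not_le by blast
  have "m < card (factors x m)" for m
  proof (induction m)
    case 0
    then show ?case by (simp add: factors_def factor_def)
  next
    case (Suc m)
    then show ?case using grow [of m] by simp
  qed
  then show False using small leD by blast
qed

lemma unique_right_special_if_small_growth:
  assumes fin: "finite (range x)"
    and small_growth: "\<And>n. card (factors x (Suc n)) \<le> Suc (card (factors x n))"
  shows "unique_right_special x"
proof -
  have "factor x i n = factor x j n"
    if i': "factor x i n = factor x i' n" "x (i + n) \<noteq> x (i' + n)"
      and j': "factor x j n = factor x j' n" "x (j + n) \<noteq> x (j' + n)" for n i i' j j'
  proof (rule ccontr)
    assume neq: "factor x i n \<noteq> factor x j n"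
    define U where "U = {factor x i (Suc n), factor x j (Suc n)}"
    define V where "V = {factor x i' (Suc n), factor x j' (Suc n)}"
    define W where "W = factors x (Suc n) - U"
    have same_prefixes: "take n ` U = take n ` V"
      using i'(1) j'(1) by (simp add: U_def V_def take_factor)
    have diff: "factor x k (Suc n) \<noteq> factor x l (Suc n)"
      if "factor x k n \<noteq> factor x l n \<or> x (k + n) \<noteq> x (l + n)" for k l
      using that by (auto simp: factor_eq_iff less_Suc_eq)
    have "V \<subseteq> W"
      using diff neq i' j' by (simp add: U_def V_def W_def factor_in_factors)
    then have "take n ` factors x (Suc n) \<subseteq> take n ` W"
      using same_prefixes unfolding W_def by blast
    then have "card (factors x n) \<le> card W"
      using surj_card_le [of W] finite_factors [OF fin] by (simp add: take_factors_Suc W_def)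
    moreover have "card U = 2" using neq diff by (simp add: U_def)
    then have "card W + 2 = card (factors x (Suc n))"
      unfolding W_def using finite_factors [OF fin] card_mono [of "factors x (Suc n)" U]
      by (subst card_Diff_subset) (auto simp: U_def factor_in_factors)
    ultimately show False using small_growth [of n] by simp
  qed
  then show ?thesis
    unfolding unique_right_special_def right_special_def factor_eq_iff_agree by blast
qed

section \<open>Two-sided extensions\<close>

definition recurrent :: "(nat \<Rightarrow> 'a) \<Rightarrow> bool" where
  "recurrent x \<longleftrightarrow> (\<forall>n. \<exists>j. factor x (Suc j) n = factor x 0 n)"

definition orbit_closure :: "(nat \<Rightarrow> 'a) \<Rightarrow> (nat \<Rightarrow> 'a) set" where
  "orbit_closure x = {y. \<forall>n. factor y 0 n \<in> factors x n}"

definition two_sided_extension :: "(nat \<Rightarrow> 'a) \<Rightarrow> (int \<Rightarrow> 'a) \<Rightarrow> bool" where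
  "two_sided_extension x z \<longleftrightarrow>
     (\<forall>i. z (int i) = x i) \<and> (\<forall>i n. \<exists>j. \<forall>k<n. z (i + int k) = x (j + k))"

lemma orbit_closure_extend_left:
  assumes fin: "finite (range x)" and recurrent: "recurrent x" and y: "y \<in> orbit_closure x"
  shows "\<exists>c. case_nat c y \<in> orbit_closure x"
proof (rule ccontr)
  assume "\<not> ?thesis"
  then have "\<forall>c. \<exists>n. factor (case_nat c y) 0 n \<notin> factors x n"
    by (simp add: orbit_closure_def)
  then obtain f where f: "\<And>c. factor (case_nat c y) 0 (f c) \<notin> factors x (f c)" by metis
  define n where "n = Max (f ` range x)"
  have f_le: "f (x i) \<le> n" for i unfolding n_def using fin by (intro Max_ge) auto
  have "factor y 0 n \<in> factors x n" using y by (simp add: orbit_closure_def)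
  then obtain j where "factor x j n = factor y 0 n" unfolding factors_def by force
  then obtain j where j: "factor x (Suc j) n = factor y 0 n"
    using recurrent unfolding recurrent_def by (metis not0_implies_Suc)
  have "x (j + k) = case_nat (x j) y k" if "k < Suc n" for k
    using j that by (cases k) (auto simp: factor_eq_iff)
  then have "factor x j (f (x j)) = factor (case_nat (x j) y) 0 (f (x j))"
    using f_le [of j] by (auto simp: factor_eq_iff)
  then show False using f factor_in_factors by metis
qed

lemma orbit_closure_backward_orbit:
  assumes "finite (range x)" "recurrent x"
  obtains ys where "ys 0 = x" "\<And>n. ys n \<in> orbit_closure x"
    "\<And>m k i. ys (m + k) (i + k) = ys m i"
proof -
  have "\<exists>ys. \<forall>n. (ys n \<in> orbit_closure x \<and> (n = 0 \<longrightarrow> ys n = x)) \<and> (\<forall>i. ys (Suc n) (Suc i) = ys n i)"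
  proof (rule dependent_nat_choice)
    show "\<exists>y. y \<in> orbit_closure x \<and> (0 = 0 \<longrightarrow> y = x)"
      by (auto simp: orbit_closure_def factor_in_factors)
  next
    fix y and n :: nat
    assume "y \<in> orbit_closure x \<and> (n = 0 \<longrightarrow> y = x)"
    then obtain c where "case_nat c y \<in> orbit_closure x"
      using orbit_closure_extend_left assms by blast
    then show "\<exists>y'. (y' \<in> orbit_closure x \<and> (Suc n = 0 \<longrightarrow> y' = x)) \<and> (\<forall>i. y' (Suc i) = y i)"
      by (intro exI [of _ "case_nat c y"]) auto
  qed
  then obtain ys where ys: "ys 0 = x" "\<And>n. ys n \<in> orbit_closure x"
    and Suc: "\<And>n i. ys (Suc n) (Suc i) = ys n i" by metis
  have "ys (m + k) (i + k) = ys m i" for m k i by (induction k) (auto simp: Suc)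
  with ys show thesis by (rule that)
qed

lemma two_sided_extension_exists:
  assumes "finite (range x)" "recurrent x"
  obtains z where "two_sided_extension x z"
proof -
  obtain ys where ys: "ys 0 = x" "\<And>n. ys n \<in> orbit_closure x"
    and shift: "\<And>m k i. ys (m + k) (i + k) = ys m i"
    using orbit_closure_backward_orbit [OF assms] by blast
  define z where "z i = ys (nat (- i)) (nat i)" for i
  have z_diff: "z (int i - int n) = ys n i" for i n
  proof (cases "n \<le> i")
    case True
    then show ?thesis using shift [of 0 n "i - n"] by (simp add: z_def nat_diff_distrib)
  next
    case False
    then show ?thesis using shift [of "n - i" i 0] by (simp add: z_def nat_diff_distrib)
  qed
  have "\<exists>j. \<forall>k<n. z (i + int k) = x (j + k)" for i n
  proof -
    obtain j where "factor (ys (nat (- i))) 0 (nat i + n) = factor x j (nat i + n)"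
      using ys(2) [of "nat (- i)"] unfolding orbit_closure_def factors_def by blast
    then have "ys (nat (- i)) (nat i + k) = x (j + (nat i + k))" if "k < n" for k
      using that by (simp add: factor_eq_iff)
    moreover have "i + int k = int (nat i + k) - int (nat (- i))" for k by simp
    then have "z (i + int k) = ys (nat (- i)) (nat i + k)" for k using z_diff by metis
    ultimately show ?thesis by (metis add.assoc)
  qed
  then have "two_sided_extension x z"
    unfolding two_sided_extension_def by (simp add: z_def ys(1))
  then show thesis by (rule that)
qed

lemma two_sided_extension_range:
  assumes "two_sided_extension x z"
  shows "range z = range x"
proof
  show "range x \<subseteq> range z"
    using assms unfolding two_sided_extension_def by (metis image_subsetI rangeI)
  show "range z \<subseteq> range x"
  proof
    fix c assume "c \<in> range z"
    then obtain i where "c = z i" by blast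
    moreover obtain j where "\<forall>k<1. z (i + int k) = x (j + k)"
      using assms unfolding two_sided_extension_def by blast
    ultimately show "c \<in> range x" by simp
  qed
qed

lemma agree_of_nat_iff:
  "agree z (i :: int) j (int n) \<longleftrightarrow> (\<forall>k<n. z (i + int k) = z (j + int k))"
proof -
  have "{0..<int n} = int ` {..<n}"
    by (simp add: image_int_atLeastLessThan lessThan_atLeast0)
  then show ?thesis by (auto simp: agree_def)
qed

lemma two_sided_extension_unique_right_special:
  assumes ext: "two_sided_extension x z" and "unique_right_special x"
  shows "unique_right_special z"
  unfolding unique_right_special_def
proof (intro allI impI)
  fix n i j assume special: "right_special z n i" "right_special z n j"
  show "agree z i j n"
  proof (cases "0 \<le> n")
    case False
    then show ?thesis by (simp add: agree_def)
  next
    case True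
    then obtain m where n: "n = int m" by (metis zero_le_imp_eq_int)
    have "\<exists>j. \<forall>k<Suc m. z (i + int k) = x (j + k)" for i
      using ext unfolding two_sided_extension_def by blast
    then obtain w where w: "\<And>i k. k \<le> m \<Longrightarrow> z (i + int k) = x (w i + k)"
      unfolding less_Suc_eq_le by metis
    have agree: "agree z i j n \<longleftrightarrow> agree x (w i) (w j) m" for i j
      by (simp add: n agree_of_nat_iff w factor_eq_iff flip: factor_eq_iff_agree)
    have "right_special x m (w i)" if "right_special z n i" for i
      using that w [of m] unfolding right_special_def agree by (auto simp: n)
    then show ?thesis using special assms(2) agree unfolding unique_right_special_def by blast
  qed
qed

section \<open>Gaps between occurrences of bispecial factors\<close>

text \<open>
  A level describes the return words of a bispecial factor \<open>w\<close> of length \<open>n\<close>, with \<open>S\<close> a set of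
  occurrences of \<open>w\<close>. The letter \<open>c\<close> that follows an occurrence also precedes the next one, at
  distance \<open>gap c\<close>.
\<close>

locale level =
  fixes z :: "int \<Rightarrow> 'a" and a b :: 'a and gap :: "'a \<Rightarrow> int" and n :: int and S :: "int set"
  assumes distinct: "a \<noteq> b" and binary: "range z \<subseteq> {a, b}"
    and gap_pos: "0 < gap a" "0 < gap b" and gaps: "gap a + gap b = n + 2"
    and occurrences: "m \<in> S \<Longrightarrow> m' \<in> S \<Longrightarrow> agree z m m' n"
    and next_in: "m \<in> S \<Longrightarrow> m + gap (z (m + n)) \<in> S"
    and next_letter: "m \<in> S \<Longrightarrow> z (m + gap (z (m + n)) - 1) = z (m + n)"
    and prev_in: "m \<in> S \<Longrightarrow> m - gap (z (m - 1)) \<in> S"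
    and prev_letter: "m \<in> S \<Longrightarrow> z (m - gap (z (m - 1)) + n) = z (m - 1)"
begin

lemma swap: "level z b a gap n S"
  using distinct binary gap_pos gaps occurrences next_in next_letter prev_in prev_letter
  by unfold_locales auto

lemma letter_cases: obtains "z i = a" | "z i = b"
  using binary by blast

lemma occurrences_right: "m \<in> S \<Longrightarrow> m' \<in> S \<Longrightarrow> z (m + n) = z (m' + n) \<Longrightarrow> agree z m m' (n + 1)"
  using occurrences agree_snoc by blast

lemma occurrences_left:
  "m \<in> S \<Longrightarrow> m' \<in> S \<Longrightarrow> z (m - 1) = z (m' - 1) \<Longrightarrow> agree z (m - 1) (m' - 1) (n + 1)"
  using occurrences agree_cons by blast

definition isolated :: "'a \<Rightarrow> bool" where
  "isolated c \<longleftrightarrow> (\<forall>m\<in>S. z (m + n) = c \<longrightarrow> z (m + gap c + n) \<noteq> c)"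

lemma letter_changes:
  assumes aperiodic: "\<not> eventually_periodic (\<lambda>k. z (int k))" and "m \<in> S" "z (m + n) = a"
  shows "\<exists>m'\<in>S. z (m' + n) = a \<and> z (m' + gap a + n) \<noteq> a"
proof (rule ccontr)
  assume always_a: "\<not> ?thesis"
  have orbit: "m + int k * gap a \<in> S \<and> z (m + int k * gap a + n) = a" for k
  proof (induction k)
    case 0
    then show ?case using assms(2,3) by simp
  next
    case (Suc k)
    then show ?case
      using always_a next_in [of "m + int k * gap a"] by (auto simp: algebra_simps)
  qed
  have "z (i + gap a) = z i" if "i \<ge> m" for i
  proof -
    define k where "k = nat ((i - m) div gap a)"
    define r where "r = (i - m) mod gap a"
    have k: "int k = (i - m) div gap a"
      using that gap_pos by (simp add: k_def pos_imp_zdiv_nonneg_iff)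
    have i: "i = m + int k * gap a + r"
      using div_mult_mod_eq [of "i - m" "gap a"] unfolding k r_def by linarith
    have "0 \<le> r" "r < gap a" using gap_pos by (simp_all add: r_def)
    then have r: "0 \<le> r" "r < n + 1" using gap_pos gaps by auto
    have "agree z (m + int k * gap a) (m + int (Suc k) * gap a) (n + 1)"
      using orbit [of k] orbit [of "Suc k"] by (intro occurrences_right) auto
    from agreeD [OF this r] have "z i = z (m + int (Suc k) * gap a + r)" unfolding i .
    also have "m + int (Suc k) * gap a + r = i + gap a" unfolding i by (simp add: algebra_simps)
    finally show ?thesis by (rule sym)
  qed
  then have "\<forall>i\<ge>nat m. z (int (i + nat (gap a))) = z (int i)" using gap_pos by simp
  then show False
    using aperiodic gap_pos unfolding eventually_periodic_def by (metis zero_less_nat_eq)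
qed

lemma right_special_if_not_isolated:
  assumes "\<not> eventually_periodic (\<lambda>k. z (int k))" and "\<not> isolated a"
  obtains i where "z i = a" "right_special z (n + 1) i"
proof -
  obtain m where m: "m \<in> S" "z (m + n) = a" "z (m + gap a + n) = a"
    using assms(2) unfolding isolated_def by auto
  obtain m' where m': "m' \<in> S" "z (m' + n) = a" "z (m' + gap a + n) \<noteq> a"
    using letter_changes assms(1) m by blast
  have i: "z (m + gap a - 1) = a" using next_letter [OF m(1)] m(2) by simp
  have "agree z (m + gap a - 1) (m' + gap a - 1) (n + 1)"
    using next_in next_letter m m' by (intro occurrences_left) metis+
  then have "right_special z (n + 1) (m + gap a - 1)"
    using m(3) m'(3) unfolding right_special_def
    by (intro exI [of _ "m' + gap a - 1"]) (simp add: algebra_simps)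
  with i show thesis by (rule that)
qed

lemma isolated_letter:
  assumes aperiodic: "\<not> eventually_periodic (\<lambda>k. z (int k))" and unique: "unique_right_special z"
  shows "isolated a \<or> isolated b"
proof (rule ccontr)
  assume "\<not> ?thesis"
  then obtain i j where "z i = a" "right_special z (n + 1) i" "z j = b" "right_special z (n + 1) j"
    using right_special_if_not_isolated level.right_special_if_not_isolated [OF swap] aperiodic
    by metis
  then show False
    using unique agreeD [of z i j "n + 1" 0] gap_pos gaps distinct
    unfolding unique_right_special_def by auto
qed

lemma isolated_next: "isolated b \<Longrightarrow> m \<in> S \<Longrightarrow> z (m + n) = b \<Longrightarrow> z (m + gap b + n) = a"
  unfolding isolated_def using binary by blast

lemma isolated_prev:
  assumes "isolated b" "m \<in> S" "z (m + n) = b"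
  shows "z (m - 1) = a"
proof (rule ccontr)
  assume "z (m - 1) \<noteq> a"
  then have "z (m - 1) = b" using binary by blast
  then show False
    using isolated_next [of "m - gap b"] prev_in [of m] prev_letter [of m] assms distinct by simp
qed

lemma isolated_two_gaps_before:
  assumes isolated: "isolated b" and m: "m \<in> S" "z (m - 1) = b"
  shows "z (m - gap b + n) = b" "m - (gap a + gap b) \<in> S" "z (m - (gap a + gap b) + n) = a"
proof -
  define l where "l = m - gap b"
  have l: "l \<in> S" "z (l + n) = b" using m prev_in prev_letter by (auto simp: l_def)
  then show "z (m - gap b + n) = b" by (simp add: l_def)
  have "z (l - 1) = a" using l by (rule isolated_prev [OF isolated])
  then show "m - (gap a + gap b) \<in> S" "z (m - (gap a + gap b) + n) = a"
    using l(1) prev_in [of l] prev_letter [of l] by (simp_all add: l_def algebra_simps)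
qed

lemma merge:
  assumes isolated: "isolated b"
  shows "level z a b (gap(b := gap a + gap b)) (n + gap a) {m \<in> S. z (m + n) = a}"
    (is "level z a b ?gap ?n ?T")
proof
  show "a \<noteq> b" "range z \<subseteq> {a, b}" by (fact distinct, fact binary)
  show "0 < ?gap a" "0 < ?gap b" "?gap a + ?gap b = ?n + 2"
    using distinct gap_pos gaps by simp_all
next
  fix m m' assume m: "m \<in> ?T" "m' \<in> ?T"
  then have "agree z (m + gap a) (m' + gap a) n"
    using next_in [of m] next_in [of m'] by (intro occurrences) auto
  moreover have "agree z m m' (n + 1)" using m occurrences_right by simp
  ultimately have "agree z m m' (gap a + n)"
    using gap_pos gaps by (intro agree_overlap) auto
  then show "agree z m m' (n + gap a)" by (simp add: add.commute)
next
  fix m assume m: "m \<in> ?T"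
  define l where "l = m + gap a"
  have l: "l \<in> S" "z (l - 1) = a" and shift: "m + (n + gap a) = l + n"
    using m next_in [of m] next_letter [of m] by (auto simp: l_def)
  show "m + ?gap (z (m + ?n)) \<in> ?T"
    using l isolated_next [OF isolated, of l] next_in [of l] distinct
    unfolding shift by (cases rule: letter_cases [of "l + n"]) (auto simp: l_def algebra_simps)
  show "z (m + ?gap (z (m + ?n)) - 1) = z (m + ?n)"
    using l next_letter [of l] distinct
    unfolding shift by (cases rule: letter_cases [of "l + n"]) (auto simp: l_def algebra_simps)
  show "m - ?gap (z (m - 1)) \<in> ?T" "z (m - ?gap (z (m - 1)) + ?n) = z (m - 1)"
    using m prev_in [of m] prev_letter [of m] isolated_two_gaps_before [OF isolated, of m] distinct
    by (cases rule: letter_cases [of "m - 1"]; auto simp: algebra_simps)+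
qed

definition first_occurrence :: "int \<Rightarrow> bool" where
  "first_occurrence e \<longleftrightarrow> e \<in> S \<and> 0 \<le> e \<and> e < gap (z (e - 1))"

end

datatype kind = Short | Long

primrec kind_length :: "int \<Rightarrow> int \<Rightarrow> kind \<Rightarrow> int" where
  "kind_length p q Short = p"
| "kind_length p q Long = q"

definition kind_of :: "'a \<Rightarrow> 'a \<Rightarrow> kind" where
  "kind_of a c = (if c = a then Short else Long)"

text \<open>
  In \<open>gap_state z p q e x y\<close>, \<open>e\<close> is the first nonnegative occurrence of a bispecial factor with gaps
  \<open>p \<le> q\<close>, and \<open>x\<close>, \<open>y\<close> are the kinds of the gaps that end and start there.
\<close>

definition gap_state :: "(int \<Rightarrow> 'a) \<Rightarrow> int \<Rightarrow> int \<Rightarrow> int \<Rightarrow> kind \<Rightarrow> kind \<Rightarrow> bool" where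
  "gap_state z p q e x y \<longleftrightarrow> p \<le> q \<and> (\<exists>a b gap n S. level z a b gap n S \<and> p = gap a \<and> q = gap b \<and>
     level.first_occurrence z gap S e \<and> x = kind_of a (z (e - 1)) \<and> y = kind_of a (z (e + n)))"

lemma gap_stateI:
  assumes "level z a b gap n S" "gap a \<le> gap b" "level.first_occurrence z gap S e"
  shows "gap_state z (gap a) (gap b) e (kind_of a (z (e - 1))) (kind_of a (z (e + n)))"
  using assms unfolding gap_state_def by blast

context level
begin

lemma gap_state_merge:
  assumes isolated: "isolated b" and first: "first_occurrence e"
  shows "\<exists>y. gap_state z (gap a) (gap a + gap b) (if z (e + n) = a then e else e + gap b)
           (if z (e - 1) = a \<and> z (e + n) = a then Short else Long) y"
proof -
  let ?gap = "gap(b := gap a + gap b)" and ?T = "{m \<in> S. z (m + n) = a}"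
  let ?e = "if z (e + n) = a then e else e + gap b"
  have e: "e \<in> S" "0 \<le> e" "e < gap (z (e - 1))"
    using first by (auto simp: first_occurrence_def)
  have prev: "z (e - 1) = a \<or> z (e + n) = a"
    using isolated_prev [OF isolated e(1)] letter_cases by blast
  have "?e \<in> ?T" "?e < ?gap (z (?e - 1))"
    and kind: "z (?e - 1) = a \<longleftrightarrow> z (e - 1) = a \<and> z (e + n) = a"
    using e prev isolated_next [OF isolated, of e] next_in [of e] next_letter [of e]
      gap_pos distinct
    by (cases rule: letter_cases [of "e + n"]; cases rule: letter_cases [of "e - 1"]; force)+
  moreover have "0 \<le> ?e" using e gap_pos by simp
  ultimately have "level.first_occurrence z ?gap ?T ?e"
    by (simp only: level.first_occurrence_def [OF merge [OF isolated]])
  from gap_stateI [OF merge [OF isolated] _ this] show ?thesis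
    using distinct gap_pos unfolding kind_of_def kind by auto
qed

lemma agree_prefix:
  assumes "first_occurrence e"
  shows "agree z 0 (gap (z (e - 1))) (n - gap (z (e - 1)) + e)"
  using agree_drop [OF occurrences [OF prev_in], of e e "gap (z (e - 1)) - e"] assms
  by (simp add: first_occurrence_def algebra_simps)

lemma agree_prefix_if_repeated:
  assumes "first_occurrence e" and repeated: "z (e - 1) = z (e + n)"
  shows "agree z 0 (gap (z (e - 1))) (n + e)"
proof -
  let ?u = "gap (z (e - 1))"
  have e: "e \<in> S" "e < ?u" using assms(1) by (auto simp: first_occurrence_def)
  have "agree z (e - ?u) e (n + 1)"
    using prev_in [OF e(1)] prev_letter [OF e(1)] e(1) repeated
    by (intro occurrences_right) simp_all
  then have "agree z 0 ?u (n + 1 - (?u - e))"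
    using agree_drop [of z "e - ?u" e "n + 1" "?u - e"] e(2) by simp
  moreover have "agree z (0 + e) (?u + e) n"
    using occurrences [OF e(1) next_in [OF e(1)]] repeated by (simp add: add.commute)
  moreover have "e \<le> n + 1 - (?u - e)"
    using gap_pos gaps by (cases rule: letter_cases [of "e - 1"]) auto
  ultimately show ?thesis using agree_overlap by (metis add.commute)
qed

end

lemma gap_state_pos: "gap_state z p q e x y \<Longrightarrow> 0 < p \<and> p \<le> q \<and> 0 \<le> e"
  unfolding gap_state_def
  by (auto dest: level.gap_pos simp: level.first_occurrence_def)

text \<open>\<open>k\<close> is the kind of the gap that survives the merging, and the other gap is isolated.\<close>

lemma gap_state_step:
  assumes aperiodic: "\<not> eventually_periodic (\<lambda>k. z (int k))" and unique: "unique_right_special z"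
    and state: "gap_state z p q e x y"
  obtains k y' where
    "gap_state z (kind_length p q k) (p + q) (if y = k then e else e + kind_length p q y)
           (if x = k \<and> y = k then Short else Long) y'"
proof -
  obtain a b gap n S where L: "level z a b gap n S" and pq: "p = gap a" "q = gap b"
    and first: "level.first_occurrence z gap S e"
    and xy: "x = kind_of a (z (e - 1))" "y = kind_of a (z (e + n))"
    using state unfolding gap_state_def by blast
  interpret level z a b gap n S by (fact L)
  interpret swapped: level z b a gap n S by (fact swap)
  have ab: "z i = b \<longleftrightarrow> z i \<noteq> a" for i
    using binary distinct by blast
  consider "isolated b" | "isolated a" using isolated_letter aperiodic unique by blast
  then show thesis
  proof cases
    case 1
    then show thesis
      using that [of Short] gap_state_merge [OF 1 first]
      by (auto simp: xy pq kind_of_def split: if_splits)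
  next
    case 2
    then show thesis
      using that [of Long] swapped.gap_state_merge [OF 2 first]
      by (auto simp: xy pq ab kind_of_def add.commute split: if_splits)
  qed
qed

lemma gap_state_agree:
  assumes "gap_state z p q e x y"
  shows "agree z e (e + kind_length p q y) (p + q - 2)"
    and "agree z 0 (kind_length p q x) (p + q - 2 - kind_length p q x + e)"
    and "x = y \<Longrightarrow> agree z 0 (kind_length p q x) (p + q - 2 + e)"
proof -
  obtain a b gap n S where L: "level z a b gap n S" and pq: "p = gap a" "q = gap b"
    and first: "level.first_occurrence z gap S e"
    and xy: "x = kind_of a (z (e - 1))" "y = kind_of a (z (e + n))"
    using assms unfolding gap_state_def by blast
  interpret level z a b gap n S by (fact L)
  have n: "p + q - 2 = n" and x: "kind_length p q x = gap (z (e - 1))"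
    and y: "kind_length p q y = gap (z (e + n))"
    using gaps binary by (auto simp: pq xy kind_of_def)
  show "agree z e (e + kind_length p q y) (p + q - 2)"
    unfolding n y using first occurrences next_in by (simp add: first_occurrence_def)
  show "agree z 0 (kind_length p q x) (p + q - 2 - kind_length p q x + e)"
    unfolding n x using agree_prefix [OF first] .
  show "agree z 0 (kind_length p q x) (p + q - 2 + e)" if "x = y"
  proof -
    have "z (e - 1) = z (e + n)"
      using that binary by (auto simp: xy kind_of_def split: if_splits)
    then show ?thesis unfolding n x by (rule agree_prefix_if_repeated [OF first])
  qed
qed

lemma gap_state_init:
  assumes "card (range z) = 2"
  shows "\<exists>x y. gap_state z 1 1 0 x y"
proof -
  obtain a b where "a \<noteq> b" "range z = {a, b}" using assms by (meson card_2_iff)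
  then have init: "level z a b (\<lambda>_. 1) 0 UNIV" by unfold_locales (auto simp: agree_def)
  then have "level.first_occurrence z (\<lambda>_. 1) UNIV 0" by (simp add: level.first_occurrence_def)
  from gap_stateI [OF init _ this] show ?thesis by blast
qed

section \<open>Linear inequalities between gaps\<close>

text \<open>
  The matrix of the recurrence has eigenvalues \<open>3 + sqrt 10\<close>, \<open>3 - sqrt 10\<close> and 1, and the last two
  have the left eigenvectors \<open>(5, - sqrt 10, 0)\<close> and \<open>(- 1, - 2, 3)\<close> in the coordinates \<open>P, Q, E\<close>.
\<close>

locale gap_recurrence =
  fixes P Q E :: "nat \<Rightarrow> int"
  assumes P_Suc: "P (Suc k) = 3 * P k + 2 * Q k" and Q_Suc: "Q (Suc k) = 5 * P k + 3 * Q k"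
    and E_Suc: "E (Suc k) = E k + 4 * P k + 2 * Q k"
    and start: "0 < P 0" "0 \<le> Q 0"
begin

lemma Q_unbounded: "real k \<le> of_int (Q k)"
proof -
  have "0 < P k \<and> int k \<le> Q k" by (induction k) (use start P_Suc Q_Suc in auto)
  then show ?thesis by (metis of_int_le_iff of_int_of_nat_eq)
qed

lemma contracting_combination:
  "\<bar>5 * real_of_int (P k) - sqrt 10 * of_int (Q k)\<bar> \<le>
   \<bar>5 * real_of_int (P 0) - sqrt 10 * of_int (Q 0)\<bar>"
  (is "\<bar>?u k\<bar> \<le> _")
proof (induction k)
  case (Suc k)
  have "3 \<le> sqrt 10" "sqrt 10 \<le> 4" by (auto intro: real_le_rsqrt real_le_lsqrt)
  moreover have "?u (Suc k) = (3 - sqrt 10) * ?u k" by (simp add: P_Suc Q_Suc algebra_simps)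
  ultimately have "\<bar>?u (Suc k)\<bar> \<le> \<bar>?u k\<bar>"
    by (simp add: abs_mult mult_left_le_one_le)
  with Suc show ?case by simp
qed simp

lemma conserved_combination: "3 * E k - P k - 2 * Q k = 3 * E 0 - P 0 - 2 * Q 0"
  by (induction k) (simp_all add: P_Suc Q_Suc E_Suc)

text \<open>The bound is the ratio of \<open>Q\<close> and \<open>P + E\<close> in the dominant eigenvector.\<close>

lemma ratio_bound:
  assumes bound: "\<And>k. \<gamma> * of_int (P k + E k - 2) \<le> of_int (Q k)"
  shows "\<gamma> \<le> sqrt 10 - 5 / 2"
proof (rule ccontr)
  assume "\<not> ?thesis"
  then have gamma: "sqrt 10 - 5 / 2 < \<gamma>" by simp
  have sqrt10: "3 \<le> sqrt 10" by (rule real_le_rsqrt) simp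
  define u where "u k = 5 * real_of_int (P k) - sqrt 10 * of_int (Q k)" for k
  define v where "v = 3 * E 0 - P 0 - 2 * Q 0"
  define \<delta> where "\<delta> = \<gamma> * (4 / 5 * sqrt 10 + 2) - 3"
  define C where "C = \<gamma> * (6 + \<bar>of_int v\<bar> + 4 / 5 * \<bar>u 0\<bar>)"
  have "3 = (sqrt 10 - 5 / 2) * (4 / 5 * sqrt 10 + 2)" by (simp add: field_simps)
  also have "\<dots> < \<gamma> * (4 / 5 * sqrt 10 + 2)"
    using gamma sqrt10 by (intro mult_strict_right_mono) auto
  finally have "0 < \<delta>" by (simp add: \<delta>_def)
  have Q_bounded: "\<delta> * of_int (Q k) \<le> C" for k
  proof -
    have u_bounded: "\<bar>u k\<bar> \<le> \<bar>u 0\<bar>" unfolding u_def by (rule contracting_combination)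
    have "real_of_int v = 3 * of_int (E k) - of_int (P k) - 2 * of_int (Q k)"
      unfolding v_def conserved_combination [of k, symmetric] by simp
    then have decomposition: "3 * real_of_int (P k + E k - 2) =
        4 / 5 * u k + (4 / 5 * sqrt 10 + 2) * of_int (Q k) + of_int v - 6"
      by (simp add: u_def algebra_simps)
    have "\<gamma> * (3 * real_of_int (P k + E k - 2)) = 3 * (\<gamma> * of_int (P k + E k - 2))"
      by (rule mult.left_commute)
    also have "\<dots> \<le> 3 * of_int (Q k)" using bound [of k] by (intro mult_left_mono) auto
    finally have "\<delta> * of_int (Q k) \<le> \<gamma> * (6 - of_int v - 4 / 5 * u k)"
      unfolding decomposition by (simp add: \<delta>_def algebra_simps)
    also have "\<dots> \<le> C"
      unfolding C_def using gamma sqrt10 u_bounded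
      by (intro mult_left_mono) (auto simp: abs_if split: if_splits)
    finally show ?thesis .
  qed
  obtain k :: nat where "C < k * \<delta>" using reals_Archimedean3 \<open>0 < \<delta>\<close> by blast
  also have "\<dots> \<le> \<delta> * of_int (Q k)" using Q_unbounded [of k] \<open>0 < \<delta>\<close> by simp
  finally show False using Q_bounded [of k] by simp
qed

end

lemma factor_Suc: "factor d n (Suc m) = d n # factor d (Suc n) m"
  by (simp add: factor_def upt_conv_Cons map_Suc_upt [symmetric] del: upt_Suc)

lemma factor_0: "factor d n 0 = []"
  by (simp add: factor_def)

lemmas factor_simps = numeral_eq_Suc factor_Suc factor_0

locale pattern_avoiding =
  fixes d :: "nat \<Rightarrow> kind"
  assumes no_Short_Long_Short: "factor d n 3 \<noteq> [Short, Long, Short]"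
    and no_Long_Short_Short: "factor d n 3 \<noteq> [Long, Short, Short]"
    and no_Long_Long_Long_Long: "factor d n 4 \<noteq> [Long, Long, Long, Long]"
    and no_Long_Short_Long_Long_Short: "factor d n 5 \<noteq> [Long, Short, Long, Long, Short]"
begin

lemma block_after_Long_Short:
  assumes "d i = Long" "d (Suc i) = Short"
  shows "factor d (Suc i) 4 = [Short, Long, Long, Long]" "d (i + 5) = Short"
proof -
  have second: "d (i + 2) = Long"
    using no_Long_Short_Short [of i] assms by (cases "d (i + 2)") (simp_all add: factor_simps)
  then have third: "d (i + 3) = Long"
    using no_Short_Long_Short [of "Suc i"] assms
    by (cases "d (i + 3)") (simp_all add: factor_simps)
  then have fourth: "d (i + 4) = Long"
    using no_Long_Short_Long_Long_Short [of i] assms second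
    by (cases "d (i + 4)") (simp_all add: factor_simps)
  show "factor d (Suc i) 4 = [Short, Long, Long, Long]"
    using assms second third fourth by (simp add: factor_simps)
  show "d (i + 5) = Short"
    using no_Long_Long_Long_Long [of "i + 2"] second third fourth
    by (cases "d (i + 5)") (simp_all add: factor_simps)
qed

lemma eventually_Short_Long_Long_Long:
  assumes "d m = Long"
  shows "\<exists>N. \<forall>k. factor d (N + 4 * k) 4 = [Short, Long, Long, Long]"
proof -
  have "\<exists>n. d n = Long \<and> d (Suc n) = Short"
  proof (rule ccontr)
    assume "\<not> ?thesis"
    then have "d (Suc n) = Long" if "d n = Long" for n using that kind.exhaust by metis
    then show False using no_Long_Long_Long_Long [of m] assms by (simp add: factor_simps)
  qed
  then obtain n where n: "d n = Long" "d (Suc n) = Short" by blast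
  have "d (n + 4 * k) = Long \<and> d (Suc (n + 4 * k)) = Short" for k
  proof (induction k)
    case (Suc k)
    then show ?case using block_after_Long_Short [of "n + 4 * k"] by (simp add: factor_simps)
  qed (use n in simp)
  then have "factor d (Suc n + 4 * k) 4 = [Short, Long, Long, Long]" for k
    using block_after_Long_Short by simp
  then show ?thesis by blast
qed

end

text \<open>
  The margin between \<open>331 / 500\<close>, which is slightly below \<open>sqrt 10 - 5 / 2\<close>, and \<open>33 / 50\<close> absorbs
  the additive constant.
\<close>

lemma integer_bound:
  fixes \<gamma> :: real and m x :: int
  assumes "331 / 500 \<le> \<gamma>" "\<gamma> * of_int (m - 2) \<le> of_int x" "1000 \<le> m"
  shows "33 * m \<le> 50 * x"
proof -
  have "331 / 500 * real_of_int (m - 2) \<le> \<gamma> * of_int (m - 2)"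
    using assms(1,3) by (intro mult_right_mono) auto
  then have "331 * real_of_int (m - 2) \<le> 500 * of_int x" using assms(2) by simp
  then show ?thesis using assms(3) by simp
qed

text \<open>
  The gaps at the successive levels when the gap that ends at the first occurrence \<open>e\<close> is always
  long and the one that starts there is always short; \<open>d\<close> tells which of the gaps is kept.
\<close>

locale gap_path =
  fixes p q e :: "nat \<Rightarrow> int" and d :: "nat \<Rightarrow> kind" and \<gamma> :: real
  assumes p_Suc: "p (Suc n) = kind_length (p n) (q n) (d n)"
    and q_Suc: "q (Suc n) = p n + q n"
    and e_Suc: "e (Suc n) = (if d n = Short then e n else e n + p n)"
    and start: "0 < p 0" "p 0 \<le> q 0" "0 \<le> e 0" "2000 \<le> q 0"
    and gamma: "331 / 500 \<le> \<gamma>"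
    and right_bound: "\<gamma> * of_int (p n + q n - 2) \<le> of_int (e n + p n)"
    and left_bound: "\<gamma> * of_int (p n + e n - 2) \<le> of_int (q n)"
begin

lemma ordered: "0 < p n" "p n \<le> q n" "0 \<le> e n" "2000 \<le> q n"
proof (atomize (full), induction n)
  case (Suc n)
  then show ?case by (cases "d n") (auto simp: p_Suc q_Suc e_Suc)
qed (use start in simp)

lemma right_bound_int: "33 * (p n + q n) \<le> 50 * (e n + p n)"
  using integer_bound [OF gamma right_bound] ordered [of n] by simp

lemma left_bound_int: "33 * (p n + e n) \<le> 50 * q n"
  using integer_bound [OF gamma left_bound] ordered [of n] right_bound_int [of n] by simp

lemmas bounds = right_bound_int left_bound_int ordered

lemmas path_simps = factor_simps p_Suc q_Suc e_Suc

sublocale pattern_avoiding d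
proof
  fix n
  note bounds_3 = bounds [of n] bounds [of "n + 1"] bounds [of "n + 2"] bounds [of "n + 3"]
  note bounds_4 = bounds_3 bounds [of "n + 4"]
  note bounds_5 = bounds_4 bounds [of "n + 5"]
  show "factor d n 3 \<noteq> [Short, Long, Short]" using bounds_3 by (auto simp: path_simps)
  show "factor d n 3 \<noteq> [Long, Short, Short]" using bounds_3 by (auto simp: path_simps)
  show "factor d n 4 \<noteq> [Long, Long, Long, Long]" using bounds_4 by (auto simp: path_simps)
  show "factor d n 5 \<noteq> [Long, Short, Long, Long, Short]" using bounds_5 by (auto simp: path_simps)
qed

lemma Long_occurs: "\<exists>m. d m = Long"
proof (rule ccontr)
  assume "\<not> ?thesis"
  then have Short: "d n = Short" for n using kind.exhaust by blast
  have stationary: "p n = p 0 \<and> e n = e 0 \<and> int n \<le> q n" for n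
  proof (induction n)
    case (Suc n)
    then show ?case using ordered [of n] by (simp add: p_Suc q_Suc e_Suc Short)
  qed (use start in simp)
  show False
    using right_bound_int [of "nat (2 * (e 0 + p 0))"] stationary [of "nat (2 * (e 0 + p 0))"] start
    by auto
qed

lemma four_steps:
  assumes "factor d n 4 = [Short, Long, Long, Long]"
  shows "p (n + 4) = 3 * p n + 2 * q n" "q (n + 4) = 5 * p n + 3 * q n"
    "e (n + 4) = e n + 4 * p n + 2 * q n"
  using assms by (auto simp: path_simps)

lemma gap_path_bound: "\<gamma> \<le> sqrt 10 - 5 / 2"
proof -
  obtain m where "d m = Long" using Long_occurs by blast
  then obtain N where N: "\<And>k. factor d (N + 4 * k) 4 = [Short, Long, Long, Long]"
    using eventually_Short_Long_Long_Long by blast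
  interpret gap_recurrence "\<lambda>k. p (N + 4 * k)" "\<lambda>k. q (N + 4 * k)" "\<lambda>k. e (N + 4 * k)"
  proof
    fix k
    show "p (N + 4 * Suc k) = 3 * p (N + 4 * k) + 2 * q (N + 4 * k)"
      "q (N + 4 * Suc k) = 5 * p (N + 4 * k) + 3 * q (N + 4 * k)"
      "e (N + 4 * Suc k) = e (N + 4 * k) + 4 * p (N + 4 * k) + 2 * q (N + 4 * k)"
      using four_steps [OF N [of k]] by (simp_all add: add.commute add.left_commute)
  next
    show "0 < p (N + 4 * 0)" "0 \<le> q (N + 4 * 0)" using ordered [of N] by simp_all
  qed
  show ?thesis by (rule ratio_bound [OF left_bound])
qed

end

section \<open>Early repetitions\<close>

locale late_word =
  fixes z :: "int \<Rightarrow> 'a" and \<gamma> :: real and n0 :: int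
  assumes aperiodic: "\<not> eventually_periodic (\<lambda>k. z (int k))"
    and unique: "unique_right_special z" and binary: "card (range z) = 2"
    and late: "0 \<le> j \<Longrightarrow> 0 < l \<Longrightarrow> n0 \<le> n \<Longrightarrow> agree z j (j + l) n \<Longrightarrow>
      \<gamma> * of_int n \<le> of_int (j + l)"
    and gamma: "331 / 500 \<le> \<gamma>"
begin

definition threshold :: int where "threshold = max 2000 (2 * (n0 + 2))"

lemma right_bound:
  assumes "gap_state z p q e x y" "threshold \<le> q"
  shows "\<gamma> * of_int (p + q - 2) \<le> of_int (e + kind_length p q y)"
  using late [OF _ _ _ gap_state_agree(1) [OF assms(1)]] gap_state_pos [OF assms(1)] assms(2)
  by (cases y) (auto simp: threshold_def)

lemma right_bound_int:
  assumes "gap_state z p q e x y" "threshold \<le> q"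
  shows "33 * (p + q) \<le> 50 * (e + kind_length p q y)"
  using integer_bound [OF gamma right_bound [OF assms]] gap_state_pos [OF assms(1)] assms(2)
  by (simp add: threshold_def)

lemma equal_kinds_bound:
  assumes "gap_state z p q e x x" "threshold \<le> q"
  shows "33 * (p + q + e) \<le> 50 * kind_length p q x"
proof -
  have "\<gamma> * of_int (p + q + e - 2) \<le> of_int (kind_length p q x)"
    using late [of 0 "kind_length p q x" "p + q - 2 + e"] gap_state_agree(3) [OF assms(1)]
      gap_state_pos [OF assms(1)] assms(2)
    by (cases x) (auto simp: threshold_def algebra_simps)
  from integer_bound [OF gamma this] show ?thesis
    using gap_state_pos [OF assms(1)] assms(2) by (simp add: threshold_def)
qed

lemma kinds_differ_after_step:
  assumes state: "gap_state z p q e x y" and q: "threshold \<le> q"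
  obtains k x' y' where "x' = (if x = k \<and> y = k then Short else Long)" "x' \<noteq> y'"
    "gap_state z (kind_length p q k) (p + q) (if y = k then e else e + kind_length p q y) x' y'"
proof -
  obtain k y' where step: "gap_state z (kind_length p q k) (p + q)
      (if y = k then e else e + kind_length p q y)
      (if x = k \<and> y = k then Short else Long) y'" (is "gap_state z ?p _ ?e ?x y'")
    using gap_state_step [OF aperiodic unique state] by blast
  have pos: "0 < p" "p \<le> q" "0 \<le> e" using gap_state_pos [OF state] by auto
  have "33 * (p + q) \<le> 50 * (?e + ?p)"
    using right_bound_int [OF state q] pos by (cases y; cases k) auto
  moreover have "33 * (?p + (p + q) + ?e) \<le> 50 * kind_length ?p (p + q) ?x" if "?x = y'"
    using equal_kinds_bound [of ?p "p + q" ?e ?x] step that q pos by simp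
  moreover have "0 < ?p" "?p \<le> p + q" "0 \<le> ?e" using gap_state_pos [OF step] by auto
  ultimately have "?x \<noteq> y'" using pos by (cases y'; fastforce)
  with step show thesis by (intro that) auto
qed

definition run :: "int \<Rightarrow> int \<Rightarrow> int \<Rightarrow> bool" where
  "run p q e \<longleftrightarrow> gap_state z p q e Long Short \<and> threshold \<le> q"

lemma run_after_step:
  assumes state: "gap_state z p q e x y" and q: "threshold \<le> q" and "x \<noteq> y"
  shows "\<exists>k. run (kind_length p q k) (p + q) (if y = k then e else e + kind_length p q y)"
proof -
  obtain k x' y' where "x' = (if x = k \<and> y = k then Short else Long)" "x' \<noteq> y'"
    and step: "gap_state z (kind_length p q k) (p + q)
      (if y = k then e else e + kind_length p q y) x' y'"
    using kinds_differ_after_step [OF state q] by metis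
  then have "x' = Long" "y' = Short" using \<open>x \<noteq> y\<close> kind.exhaust by metis+
  moreover have "threshold \<le> p + q" using q gap_state_pos [OF state] by simp
  ultimately show ?thesis using step unfolding run_def by blast
qed

lemma run_step:
  assumes "run p q e"
  shows "\<exists>k. run (kind_length p q k) (p + q) (if k = Short then e else e + p)"
proof -
  obtain k where
    "run (kind_length p q k) (p + q) (if Short = k then e else e + kind_length p q Short)"
    using assms run_after_step [of p q e Long Short] unfolding run_def by blast
  then have "run (kind_length p q k) (p + q) (if k = Short then e else e + p)"
    by (cases k) simp_all
  then show ?thesis by blast
qed

lemma gap_state_unbounded: "\<exists>p q e x y. gap_state z p q e x y \<and> int k \<le> q"
proof (induction k)
  case 0
  obtain x y where "gap_state z 1 1 0 x y" using gap_state_init [OF binary] by blast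
  then show ?case by fastforce
next
  case (Suc k)
  then obtain p q e x y where state: "gap_state z p q e x y" and q: "int k \<le> q" by blast
  obtain p' e' x' y' where "gap_state z p' (p + q) e' x' y'"
    using gap_state_step [OF aperiodic unique state] by metis
  moreover have "int (Suc k) \<le> p + q" using q gap_state_pos [OF state] by simp
  ultimately show ?case by blast
qed

lemma run_exists: "\<exists>p q e. run p q e"
proof -
  obtain p q e x y where state: "gap_state z p q e x y" and "int (nat threshold) \<le> q"
    using gap_state_unbounded by blast
  then have q: "threshold \<le> q" by (simp split: if_splits)
  obtain p' e' x' y' where "gap_state z p' (p + q) e' x' y'" "x' \<noteq> y'"
    using kinds_differ_after_step [OF state q] by metis
  moreover have "threshold \<le> p + q" using q gap_state_pos [OF state] by simp
  ultimately show ?thesis using run_after_step by blast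
qed

lemma left_bound:
  assumes "run p q e"
  shows "\<gamma> * of_int (p + e - 2) \<le> of_int q"
proof -
  have state: "gap_state z p q e Long Short" and q: "threshold \<le> q"
    using assms by (auto simp: run_def)
  have "n0 \<le> p + e - 2"
    using right_bound_int [OF state q] gap_state_pos [OF state] q by (simp add: threshold_def)
  then show ?thesis
    using late [of 0 q "p + e - 2"] gap_state_agree(2) [OF state] gap_state_pos [OF state]
    by (simp add: algebra_simps)
qed

lemma run_sequence_exists:
  obtains p q e :: "nat \<Rightarrow> int" and d :: "nat \<Rightarrow> kind"
  where "\<And>n. run (p n) (q n) (e n)" "\<And>n. p (Suc n) = kind_length (p n) (q n) (d n)"
    "\<And>n. q (Suc n) = p n + q n" "\<And>n. e (Suc n) = (if d n = Short then e n else e n + p n)"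
proof -
  define run_triple where "run_triple = (\<lambda>(p, q, e). run p q e)"
  define step where
    "step k = (\<lambda>(p, q, e). (kind_length p q k, p + q, if k = Short then e else e + p))" for k
  have "\<exists>t. \<forall>n. run_triple (t n) \<and> (\<exists>k. t (Suc n) = step k (t n))"
  proof (rule dependent_nat_choice)
    show "\<exists>t. run_triple t" using run_exists by (auto simp: run_triple_def)
  next
    fix t and n :: nat
    assume "run_triple t"
    then obtain p q e where t: "t = (p, q, e)" and "run p q e"
      by (cases t) (simp add: run_triple_def)
    then obtain k where "run_triple (step k t)"
      using run_step unfolding run_triple_def step_def t prod.case by blast
    then show "\<exists>t'. run_triple t' \<and> (\<exists>k. t' = step k t)" by blast
  qed
  then obtain t d where "\<And>n. run_triple (t n)" "\<And>n. t (Suc n) = step (d n) (t n)" by metis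
  then show thesis
    by (intro that [of "fst \<circ> t" "fst \<circ> snd \<circ> t" "snd \<circ> snd \<circ> t" d])
      (simp_all add: run_triple_def step_def case_prod_unfold)
qed

lemma late_word_bound: "\<gamma> \<le> sqrt 10 - 5 / 2"
proof -
  obtain p q e d where run: "\<And>n. run (p n) (q n) (e n)"
    and step: "\<And>n. p (Suc n) = kind_length (p n) (q n) (d n)" "\<And>n. q (Suc n) = p n + q n"
      "\<And>n. e (Suc n) = (if d n = Short then e n else e n + p n)"
    by (rule run_sequence_exists) blast
  then have state: "gap_state z (p n) (q n) (e n) Long Short" and q: "threshold \<le> q n" for n
    by (auto simp: run_def)
  interpret gap_path p q e d \<gamma>
  proof
    fix n
    show "p (Suc n) = kind_length (p n) (q n) (d n)" "q (Suc n) = p n + q n"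
      "e (Suc n) = (if d n = Short then e n else e n + p n)"
      by (rule step)+
    show "\<gamma> * of_int (p n + q n - 2) \<le> of_int (e n + p n)"
      using right_bound [OF state q] by simp
    show "\<gamma> * of_int (p n + e n - 2) \<le> of_int (q n)" by (rule left_bound [OF run])
  qed (use gap_state_pos [OF state [of 0]] q [of 0] gamma in \<open>auto simp: threshold_def\<close>)
  show ?thesis by (rule gap_path_bound)
qed

end

lemma early_repetition:
  fixes z :: "int \<Rightarrow> 'a" and \<gamma> :: real
  assumes "\<not> eventually_periodic (\<lambda>k. z (int k))" "unique_right_special z" "card (range z) = 2"
    and "sqrt 10 - 5 / 2 < \<gamma>"
  shows "\<exists>j l n. 0 \<le> j \<and> 0 < l \<and> n0 \<le> n \<and> agree z j (j + l) n \<and>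
           of_int (j + l) < \<gamma> * of_int n"
proof (rule ccontr)
  assume "\<not> ?thesis"
  then have "\<gamma> * of_int n \<le> of_int (j + l)"
    if "0 \<le> j" "0 < l" "n0 \<le> n" "agree z j (j + l) n" for j l n
    using that not_less by blast
  moreover have "3162 / 1000 \<le> sqrt 10" by (rule real_le_rsqrt) (simp add: power2_eq_square)
  ultimately interpret late_word z \<gamma> n0 using assms by unfold_locales auto
  show False using late_word_bound assms(4) by simp
qed

section \<open>Sturmian words\<close>

lemma recurrent_if_slow_growth:
  assumes fin: "finite (range x)" and aperiodic: "\<not> eventually_periodic x"
    and slow: "\<And>n. card (factors x n) \<le> Suc n"
  shows "recurrent x"
  unfolding recurrent_def
proof (rule allI, rule ccontr)
  fix n assume "\<not> (\<exists>j. factor x (Suc j) n = factor x 0 n)"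
  then have new_prefix: "factor x (Suc j) n \<noteq> factor x 0 n" for j by blast
  define tail where "tail i = x (Suc i)" for i
  have tail: "factor tail j n = factor x (Suc j) n" for j by (simp add: factor_def tail_def)
  have "factors tail n \<subseteq> factors x n - {factor x 0 n}"
    using new_prefix by (auto simp: factors_def tail)
  then have "card (factors tail n) \<le> card (factors x n - {factor x 0 n})"
    using finite_factors [OF fin] by (intro card_mono) auto
  also have "\<dots> \<le> n"
    using slow [of n] finite_factors [OF fin] by (simp add: factor_in_factors card_Diff_singleton)
  finally have "eventually_periodic tail"
    using fin by (intro Morse_Hedlund finite_subset [OF _ fin]) (auto simp: tail_def)
  then obtain M p where "0 < p" and periodic: "\<And>i. i \<ge> M \<Longrightarrow> x (Suc (i + p)) = x (Suc i)"
    unfolding eventually_periodic_def tail_def by blast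
  have "x (i + p) = x i" if "i \<ge> Suc M" for i
    using periodic [of "i - 1"] that by (cases i) auto
  then show False using aperiodic \<open>0 < p\<close> unfolding eventually_periodic_def by blast
qed

lemma sturmian_card_factors:
  assumes "sturmian s"
  shows "card (factors s n) = Suc n"
proof (cases "n = 0")
  case True
  then show ?thesis by (simp add: factors_def factor_def)
next
  case False
  then show ?thesis using assms by (simp add: sturmian_def complexity_eq_card)
qed

lemma sturmian_not_eventually_periodic:
  assumes "sturmian s"
  shows "\<not> eventually_periodic s"
proof
  assume "eventually_periodic s"
  then obtain B where "\<And>n. card (factors s n) \<le> B"
    using card_factors_bounded_if_eventually_periodic by blast
  from this [of B] show False using sturmian_card_factors [OF assms] by simp
qed

lemma sturmian_card_range:
  assumes "sturmian s"
  shows "card (range s) = 2"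
proof -
  have "factors s 1 = (\<lambda>c. [c]) ` range s" by (auto simp: factors_def factor_def)
  then have "card (factors s 1) = card (range s)" by (simp add: card_image inj_on_def)
  then show ?thesis using sturmian_card_factors [OF assms, of 1] by simp
qed

lemma sturmian_early_repetition:
  fixes s :: "nat \<Rightarrow> 'a" and \<gamma> :: real
  assumes sturmian: "sturmian s" and gamma: "sqrt 10 - 5 / 2 < \<gamma>"
  shows "\<exists>j l n. 0 < l \<and> n0 \<le> n \<and> factor s j n = factor s (j + l) n \<and>
           real (j + l) < \<gamma> * real n"
proof -
  note card_factors = sturmian_card_factors [OF sturmian]
  have fin: "finite (range s)" using sturmian by (simp add: sturmian_def)
  have aperiodic: "\<not> eventually_periodic s"
    using sturmian by (rule sturmian_not_eventually_periodic)
  have "recurrent s" using recurrent_if_slow_growth [OF fin aperiodic] card_factors by simp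
  then obtain z where ext: "two_sided_extension s z"
    using two_sided_extension_exists fin by blast
  then have z: "z (int i) = s i" for i by (simp add: two_sided_extension_def)
  have "unique_right_special s"
    using unique_right_special_if_small_growth [OF fin] card_factors by simp
  then have "unique_right_special z"
    using ext by (intro two_sided_extension_unique_right_special)
  moreover have "card (range z) = 2"
    using two_sided_extension_range [OF ext] sturmian_card_range [OF sturmian] by simp
  ultimately obtain j l n where jln: "0 \<le> j" "0 < l" "int n0 \<le> n" "agree z j (j + l) n"
      "of_int (j + l) < \<gamma> * of_int n"
    using early_repetition [of z \<gamma> "int n0"] aperiodic gamma unfolding z by blast
  then obtain j' l' n' where nat: "j = int j'" "l = int l'" "n = int n'"
    by (metis nonneg_int_cases less_imp_le of_nat_0_le_iff order_trans)
  have "factor s j' n' = factor s (j' + l') n'"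
    using jln(4) unfolding nat agree_of_nat_iff factor_eq_iff
    by (simp add: z flip: of_nat_add)
  with jln show ?thesis unfolding nat by (intro exI [of _ j'] exI [of _ l'] exI [of _ n']) auto
qed

lemma rep_fun_le:
  assumes "factor x j n = factor x (j + l) n" "0 < l"
  shows "rep_fun n x \<le> n + j + l"
  unfolding rep_fun_def
  by (rule Least_le) (use assms in \<open>auto intro!: exI [of _ "Suc j"] simp: add.assoc\<close>)

lemma rep_le_if_early_repetitions:
  assumes early: "\<And>n0. \<exists>j l n. 0 < l \<and> n0 \<le> n \<and> factor x j n = factor x (j + l) n \<and>
      real (j + l) < \<gamma> * real n"
  shows "rep x \<le> ereal (1 + \<gamma>)"
proof (rule ccontr)
  assume "\<not> ?thesis"
  then have "\<forall>\<^sub>F n in sequentially. ereal (1 + \<gamma>) < ereal (real (rep_fun n x) / real n)"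
    unfolding rep_def by (intro less_LiminfD) simp
  then obtain n0 where n0: "\<And>n. n \<ge> n0 \<Longrightarrow> 1 + \<gamma> < real (rep_fun n x) / real n"
    unfolding eventually_sequentially by auto
  obtain j l n where n: "max 1 n0 \<le> n" and early_at: "real (j + l) < \<gamma> * real n"
    and repetition: "factor x j n = factor x (j + l) n" "0 < l"
    using early by blast
  have "real (rep_fun n x) \<le> real n + real (j + l)"
    using rep_fun_le [OF repetition] by linarith
  also have "\<dots> < (1 + \<gamma>) * real n" using early_at by (simp add: distrib_right)
  also have "\<dots> < real (rep_fun n x)" using n0 [of n] n by (simp add: pos_less_divide_eq)
  finally show False .
qed

theorem theorem3p4:
  fixes s :: "nat \<Rightarrow> 'a"
  assumes "sturmian s"
  shows "rep s \<le> ereal (sqrt 10 - 3 / 2)"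
proof (rule ccontr)
  assume "\<not> ?thesis"
  then obtain c where c: "sqrt 10 - 3 / 2 < c" "ereal c < rep s"
    using ereal_dense2 by (metis less_ereal.simps(1) not_le)
  have "rep s \<le> ereal (1 + (c - 1))"
    using sturmian_early_repetition [OF assms, of "c - 1"] c(1)
    by (intro rep_le_if_early_repetitions) simp
  then show False using c(2) by simp
qed

end
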